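(* Let $m \ge 1$ and $k \ge 2$ be integers, and let $\alpha = \alpha(m) = \sqrt{2^m/(2^m-1)}$. Then $S_m(k) > \alpha^k$.
   Context: For positive integers $m$ and $k$, a $k$-term semi-progression of scope $m$ is a sequence of integers $(x_1,x_2,\ldots,x_k)$ such that for some positive integer $d$ (the low-difference), $x_{j+1}-x_j \in \{d,2d,\ldots,md\}$ for every $1 \le j \le k-1$. (Thus an arithmetic progression is a semi-progression of scope $1$.) $S_m(k)$ denotes the least positive integer $N$ such that every $2$-coloring of $\{1,2,\ldots,N\}$ contains a monochromatic $k$-term semi-progression of scope $m$. *)

theory Defs
  imports Complex_Main
begin

(* Sequences are lists, so the term x_j (1 <= j <= k) is xs ! (j - 1). *)
definition semi_progression :: "nat \<Rightarrow> nat \<Rightarrow> int list \<Rightarrow> bool" where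
  "semi_progression m k xs \<longleftrightarrow>
     length xs = k \<and>
     (\<exists>d>0. \<forall>j. Suc j < k \<longrightarrow> xs ! Suc j - xs ! j \<in> {int i * d | i. 1 \<le> i \<and> i \<le> m})"

definition monochromatic :: "(int \<Rightarrow> bool) \<Rightarrow> int list \<Rightarrow> bool" where
  "monochromatic c xs \<longleftrightarrow> (\<exists>b. \<forall>x\<in>set xs. c x = b)"

(* The two colours are the truth values; a colouring is total on the integers, but
   only its values on {1..N} matter. *)
definition semi_progression_forcing :: "nat \<Rightarrow> nat \<Rightarrow> nat \<Rightarrow> bool" where
  "semi_progression_forcing m k N \<longleftrightarrow>
     (\<forall>c :: int \<Rightarrow> bool. \<exists>xs. semi_progression m k xs \<and>
        set xs \<subseteq> {1..int N} \<and> monochromatic c xs)"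

(* For m >= 1 a suitable N exists by van der Waerden's theorem.  The operator LEAST carries no
   such guarantee, so bounds on S m k have to establish existence. *)
definition S :: "nat \<Rightarrow> nat \<Rightarrow> nat" where
  "S m k = (LEAST N. 1 \<le> N \<and> semi_progression_forcing m k N)"

definition \<alpha> :: "nat \<Rightarrow> real" where
  "\<alpha> m = sqrt (2 ^ m / (2 ^ m - 1))"

end

theory Submission
  imports Defs
begin

text \<open>
  Fix a first term \<open>a\<close> and a low-difference \<open>d\<close> and colour at random. A monochromatic
  semi-progression starting at \<open>a\<close> may be assumed greedy: from each term move on to the first of
  the next \<open>m\<close> candidates that has the right colour. Each step fails with probability
  at least \<open>2^-m\<close> given the past, so with \<open>p = 1 - 2^-m\<close> the \<open>k - 1\<close> steps succeed with
  probability at most \<open>p^(k-1)\<close>. There are at most \<open>N (N - 1) / 2\<close> pairs \<open>(a, d)\<close>, hence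
  \<open>N^2 p^(k-1) > 2\<close> and, as \<open>p \<ge> 1/2\<close>, \<open>N^2 > p^-k = \<alpha>^(2 k)\<close>.

  That some \<open>N\<close> is forcing at all is van der Waerden's theorem, proved by colour focusing.
\<close>

section \<open>Van der Waerden's theorem\<close>

text \<open>The point \<open>a + l * d\<close> after the monochromatic progression must also lie below \<open>N\<close>: it is
  the point on which progressions are focused.\<close>
definition vdw_bound :: "nat \<Rightarrow> nat \<Rightarrow> nat \<Rightarrow> bool" where
  "vdw_bound l r N \<longleftrightarrow> (\<forall>c :: nat \<Rightarrow> nat. range c \<subseteq> {..<r} \<longrightarrow>
     (\<exists>a d. d > 0 \<and> a + l * d < N \<and> (\<forall>i<l. c (a + i * d) = c a)))"

text \<open>Has \<open>l + 1\<close> terms and no extra point: the outcome of focusing, before the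
  endpoint demanded by \<open>vdw_bound (Suc l)\<close> is supplied.\<close>

definition mono_ap_below :: "(nat \<Rightarrow> nat) \<Rightarrow> nat \<Rightarrow> nat \<Rightarrow> bool" where
  "mono_ap_below c l N \<longleftrightarrow> (\<exists>a d. d > 0 \<and> a + l * d < N \<and> (\<forall>i\<le>l. c (a + i * d) = c a))"

text \<open>The focus \<open>f\<close> is the point that would extend the progression; its own
  colour is left open.\<close>

definition focused :: "(nat \<Rightarrow> nat) \<Rightarrow> nat \<Rightarrow> nat \<Rightarrow> nat \<Rightarrow> bool" where
  "focused c l f \<kappa> \<longleftrightarrow> (\<exists>a d. d > 0 \<and> a + l * d = f \<and> (\<forall>i<l. c (a + i * d) = \<kappa>))"

text \<open>Allows colour patterns of blocks, and truth values, to serve as colours: the palette is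
  enumerated by an initial segment of the naturals.\<close>

lemma vdw_bound_finite_colours:
  fixes c :: "nat \<Rightarrow> 'a"
  assumes "vdw_bound l (card C) N" "finite C" "range c \<subseteq> C"
  obtains a d where "d > 0" "a + l * d < N" "\<And>i. i < l \<Longrightarrow> c (a + i * d) = c a"
proof -
  obtain h where h: "bij_betw h C {0..<card C}"
    using ex_bij_betw_finite_nat[OF assms(2)] by blast
  have "range (h \<circ> c) \<subseteq> {..<card C}"
    using bij_betwE[OF h] assms(3) by fastforce
  then obtain a d where ad: "d > 0" "a + l * d < N" "\<forall>i<l. h (c (a + i * d)) = h (c a)"
    using assms(1) unfolding vdw_bound_def by (metis comp_apply)
  have "c (a + i * d) = c a" if "i < l" for i
    using ad(3) that h assms(3) unfolding bij_betw_def inj_on_def by (meson rangeI subsetD)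
  then show ?thesis using ad that by blast
qed

lemma mono_ap_if_focused_same_colour:
  assumes "focused c l f (c f)" "f < N"
  shows "mono_ap_below c l N"
proof -
  obtain a d where ad: "d > 0" "a + l * d = f" "\<forall>i<l. c (a + i * d) = c f"
    using assms(1) unfolding focused_def by blast
  have all: "c (a + i * d) = c f" if "i \<le> l" for i
    using ad that by (cases "i = l") auto
  have "c (a + i * d) = c a" if "i \<le> l" for i
    using all[OF that] all[of 0] by simp
  then show ?thesis
    unfolding mono_ap_below_def using ad(1,2) assms(2) by blast
qed

lemma mono_ap_below_shift:
  assumes "mono_ap_below (\<lambda>y. c (b + y)) l M" "b + M \<le> N"
  shows "mono_ap_below c l N"
proof -
  obtain a d where ad: "d > 0" "a + l * d < M" "\<forall>i\<le>l. c (b + (a + i * d)) = c (b + a)"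
    using assms(1) unfolding mono_ap_below_def by blast
  then have "d > 0 \<and> (b + a) + l * d < N \<and> (\<forall>i\<le>l. c ((b + a) + i * d) = c (b + a))"
    using assms(2) by (auto simp: add.assoc)
  then show ?thesis unfolding mono_ap_below_def by blast
qed

text \<open>Induction on the number \<open>s\<close> of focused colours. Each block of length
  \<open>M\<close> is coloured by its whole pattern, and \<open>l\<close> identical blocks in
  progression are taken. Adding \<open>d * M\<close> to the differences of the \<open>s\<close>
  progressions in the first block focuses them on the copy of \<open>f\<close> in block
  \<open>a + l * d\<close>. The copies of \<open>f\<close> in the \<open>l\<close> blocks supply one
  new colour.\<close>

lemma colour_focusing:
  assumes vdw: "\<And>r. \<exists>N. vdw_bound l r N"
  shows "\<exists>N. \<forall>c :: nat \<Rightarrow> nat. range c \<subseteq> {..<r} \<longrightarrow> mono_ap_below c l N \<or>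
           (\<exists>f<N. \<exists>K \<subseteq> {..<r}. card K = s \<and> (\<forall>\<kappa>\<in>K. focused c l f \<kappa>))"
proof (induction s)
  case 0
  show ?case
    by (rule exI[of _ 1]) (auto intro: exI[of _ "{}"])
next
  case (Suc s)
  then obtain M where M: "\<And>c :: nat \<Rightarrow> nat. range c \<subseteq> {..<r} \<Longrightarrow> mono_ap_below c l M \<or>
           (\<exists>f<M. \<exists>K \<subseteq> {..<r}. card K = s \<and> (\<forall>\<kappa>\<in>K. focused c l f \<kappa>))"
    by blast
  define C where "C = {xs :: nat list. set xs \<subseteq> {..<r} \<and> length xs = M}"
  have finC: "finite C" unfolding C_def by (rule finite_lists_length_eq) simp
  obtain W where W: "vdw_bound l (card C) W" using vdw by blast
  show ?case
  proof (rule exI[of _ "W * M"], intro allI impI)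
    fix c :: "nat \<Rightarrow> nat"
    assume c: "range c \<subseteq> {..<r}"
    define block where "block x = map (\<lambda>y. c (x * M + y)) [0..<M]" for x
    have "range block \<subseteq> C" using c unfolding block_def C_def by fastforce
    then obtain a d where ad: "d > 0" "a + l * d < W" "\<And>i. i < l \<Longrightarrow> block (a + i * d) = block a"
      using vdw_bound_finite_colours[OF W finC] by metis
    have same: "c ((a + i * d) * M + y) = c (a * M + y)" if "i < l" "y < M" for i y
      using arg_cong[OF ad(3)[OF that(1)], of "\<lambda>xs. xs ! y"] that(2) by (simp add: block_def)
    \<comment> \<open>Block \<open>a + l * d\<close> need not match the others, but it contains the
      new focus and so must lie below \<open>W * M\<close>.\<close>
    have aM: "(a + l * d) * M + M \<le> W * M"
      using mult_le_mono1[of "Suc (a + l * d)" W M] ad(2) by simp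
    then have aM': "a * M + M \<le> W * M" by (simp add: add_mult_distrib)
    let ?c = "\<lambda>y. c (a * M + y)"
    have rc: "range ?c \<subseteq> {..<r}" using c by auto
    show "mono_ap_below c l (W * M) \<or>
           (\<exists>f<W * M. \<exists>K \<subseteq> {..<r}. card K = Suc s \<and> (\<forall>\<kappa>\<in>K. focused c l f \<kappa>))"
    proof (cases "mono_ap_below ?c l M")
      case True
      then show ?thesis using mono_ap_below_shift[OF _ aM'] by blast
    next
      case False
      then obtain f K where fK: "f < M" "K \<subseteq> {..<r}" "card K = s" "\<forall>\<kappa>\<in>K. focused ?c l f \<kappa>"
        using M[OF rc] by blast
      define f' where "f' = (a + l * d) * M + f"
      have f': "f' < W * M" unfolding f'_def using aM fK(1) by linarith
      \<comment> \<open>Otherwise \<open>f\<close> would complete a monochromatic progression of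
        \<open>l + 1\<close> terms inside the block.\<close>
      have new: "?c f \<notin> K"
        using False mono_ap_if_focused_same_colour[of ?c l f M] fK(1,4) by blast
      have "focused c l f' \<kappa>" if \<kappa>: "\<kappa> \<in> insert (?c f) K" for \<kappa>
      proof (cases "\<kappa> = ?c f")
        case True
        have "M > 0" using fK(1) by simp
        moreover have "a * M + f + l * (d * M) = f'" unfolding f'_def by (simp add: algebra_simps)
        moreover have "c (a * M + f + i * (d * M)) = \<kappa>" if "i < l" for i
          using same[OF that fK(1)] True by (simp add: algebra_simps)
        ultimately show ?thesis
          unfolding focused_def using ad(1)
          by (intro exI[of _ "a * M + f"] exI[of _ "d * M"]) auto
      next
        case False
        then obtain b e where be: "e > 0" "b + l * e = f" "\<And>i. i < l \<Longrightarrow> ?c (b + i * e) = \<kappa>"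
          using fK(4) \<kappa> unfolding focused_def by blast
        \<comment> \<open>Term \<open>i\<close> lies in block \<open>a + i * d\<close>, at the
          offset \<open>b + i * e < M\<close> of the old term in block \<open>a\<close>.\<close>
        have "c (a * M + b + i * (e + d * M)) = \<kappa>" if i: "i < l" for i
        proof -
          have "i * e \<le> l * e" using i by simp
          then have "b + i * e < M" using be(2) fK(1) by linarith
          then have "c ((a + i * d) * M + (b + i * e)) = \<kappa>" using same[OF i] be(3)[OF i] by simp
          then show ?thesis by (simp add: algebra_simps)
        qed
        moreover have "a * M + b + l * (e + d * M) = f'"
          unfolding f'_def be(2)[symmetric] by (simp add: algebra_simps)
        ultimately show ?thesis
          unfolding focused_def using be(1)
          by (intro exI[of _ "a * M + b"] exI[of _ "e + d * M"]) auto
      qed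
      moreover have "insert (?c f) K \<subseteq> {..<r}" using fK(2) rc by auto
      moreover have "card (insert (?c f) K) = Suc s"
        using new fK(2,3) finite_subset[OF fK(2)] by simp
      ultimately show ?thesis using f' by blast
    qed
  qed
qed

text \<open>Induction over all \<open>r\<close> at once, since focusing invokes the hypothesis for
  the number of block patterns. With \<open>s = r\<close> every colour is focused on
  \<open>f\<close>, so the colour of \<open>f\<close> extends some progression.\<close>

theorem van_der_Waerden: "\<exists>N. vdw_bound l r N"
proof (induction l arbitrary: r)
  case 0
  show ?case unfolding vdw_bound_def by (intro exI[of _ 1]) auto
next
  case (Suc l)
  obtain N where N: "\<And>c :: nat \<Rightarrow> nat. range c \<subseteq> {..<r} \<Longrightarrow> mono_ap_below c l N \<or>
           (\<exists>f<N. \<exists>K \<subseteq> {..<r}. card K = r \<and> (\<forall>\<kappa>\<in>K. focused c l f \<kappa>))"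
    using colour_focusing[OF Suc.IH, of r r] by blast
  \<comment> \<open>Doubling \<open>N\<close> makes room for the extra endpoint: for
    \<open>l > 0\<close> the difference satisfies \<open>d \<le> l * d < N\<close>.\<close>
  have "\<exists>a d. d > 0 \<and> a + Suc l * d < Suc (2 * N) \<and> (\<forall>i<Suc l. c (a + i * d) = c a)"
    if c: "range c \<subseteq> {..<r}" for c :: "nat \<Rightarrow> nat"
  proof -
    have "mono_ap_below c l N"
    proof (rule disjE[OF N[OF c]])
      assume "\<exists>f<N. \<exists>K \<subseteq> {..<r}. card K = r \<and> (\<forall>\<kappa>\<in>K. focused c l f \<kappa>)"
      then obtain f K where fK: "f < N" "K \<subseteq> {..<r}" "card K = r" "\<forall>\<kappa>\<in>K. focused c l f \<kappa>"
        by blast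
      have "K = {..<r}" using fK(2,3) by (intro card_subset_eq) auto
      then have "c f \<in> K" using c by auto
      then show ?thesis using fK(1,4) mono_ap_if_focused_same_colour by blast
    qed simp
    then obtain a d where ad: "d > 0" "a + l * d < N" "\<forall>i\<le>l. c (a + i * d) = c a"
      unfolding mono_ap_below_def by blast
    show ?thesis
    proof (cases "l = 0")
      case True
      \<comment> \<open>A single point does not control \<open>d\<close>.\<close>
      then show ?thesis using ad by (intro exI[of _ a] exI[of _ 1]) auto
    next
      case False
      then have "d \<le> l * d" by (cases l) auto
      then have "a + Suc l * d < Suc (2 * N)" unfolding mult_Suc using ad(2) by linarith
      then show ?thesis using ad(1,3) by (intro exI[of _ a] exI[of _ d]) auto
    qed
  qed
  then show ?case unfolding vdw_bound_def by blast
qed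

text \<open>An arithmetic progression is a semi-progression with all multipliers 1, which
  \<open>m \<ge> 1\<close> permits.\<close>

lemma semi_progression_forcing_exists:
  assumes "m \<ge> 1"
  shows "\<exists>N\<ge>1. semi_progression_forcing m k N"
proof -
  obtain N where N: "vdw_bound k (card (UNIV :: bool set)) N" using van_der_Waerden by blast
  have "\<exists>xs. semi_progression m k xs \<and> set xs \<subseteq> {1..int (Suc N)} \<and> monochromatic c xs" for c
  proof -
    \<comment> \<open>The shift by 1 matches naturals counted from 0 with the interval starting at
      1.\<close>
    obtain a d where ad: "d > 0" "a + k * d < N"
        "\<And>i. i < k \<Longrightarrow> c (int (a + i * d) + 1) = c (int a + 1)"
      using vdw_bound_finite_colours[OF N finite, of "\<lambda>x. c (int x + 1)"] by (metis top_greatest)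
    define xs where "xs = map (\<lambda>i. int (a + i * d) + 1) [0..<k]"
    have "semi_progression m k xs"
      unfolding semi_progression_def
    proof (intro conjI exI[of _ "int d"] allI impI)
      fix j assume "Suc j < k"
      then have "xs ! Suc j - xs ! j = int 1 * int d" by (simp add: xs_def algebra_simps)
      then show "xs ! Suc j - xs ! j \<in> {int i * int d |i. 1 \<le> i \<and> i \<le> m}"
        using assms by blast
    qed (use ad(1) in \<open>simp_all add: xs_def\<close>)
    moreover have "set xs \<subseteq> {1..int (Suc N)}"
    proof
      fix x assume "x \<in> set xs"
      then obtain i where i: "i < k" "x = int (a + i * d) + 1" unfolding xs_def by auto
      have "i * d \<le> k * d" using i(1) by simp
      then have "a + i * d < N" using ad(2) by linarith
      then have "int (a + i * d) < int N" by (simp only: of_nat_less_iff)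
      then show "x \<in> {1..int (Suc N)}" unfolding i(2) atLeastAtMost_iff by linarith
    qed
    moreover have "monochromatic c xs"
      unfolding monochromatic_def xs_def
      by (rule exI[of _ "c (int a + 1)"]) (use ad(3) in auto)
    ultimately show ?thesis by blast
  qed
  then show ?thesis unfolding semi_progression_forcing_def by (intro exI[of _ "Suc N"]) simp
qed

section \<open>Counting greedy chains\<close>

text \<open>A semi-progression seen through the indices \<open>t\<close> of
  \<open>a + t * d\<close>: \<open>j\<close> jumps of length at most \<open>m\<close>. The start
  \<open>s\<close> is not tested, so only later points matter.\<close>

primrec chain :: "(nat \<Rightarrow> bool) \<Rightarrow> nat \<Rightarrow> nat \<Rightarrow> nat \<Rightarrow> bool" where
  "chain P m 0 s \<longleftrightarrow> True"
| "chain P m (Suc j) s \<longleftrightarrow> (\<exists>i\<in>{1..m}. P (s + i) \<and> chain P m j (s + i))"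

lemma chain_Suc_imp_chain: "chain P m (Suc j) s \<Longrightarrow> chain P m j s"
proof (induction j arbitrary: s)
  case (Suc j)
  then obtain i where "i \<in> {1..m}" "P (s + i)" "chain P m (Suc j) (s + i)"
    using chain.simps(2) by blast
  then show ?case using Suc.IH chain.simps(2) by blast
qed simp

lemma chain_cong:
  assumes "\<And>t. t > s \<Longrightarrow> P t = Q t"
  shows "chain P m j s = chain Q m j s"
  using assms
proof (induction j arbitrary: s)
  case (Suc j)
  have "P (s + i) \<and> chain P m j (s + i) \<longleftrightarrow> Q (s + i) \<and> chain Q m j (s + i)"
    if "i \<in> {1..m}" for i
    using Suc.IH[of "s + i"] Suc.prems that by simp
  then show ?case by auto
qed simp

text \<open>If the first good position \<open>s + i\<close> comes before the one used,
  \<open>s + i'\<close>, the jump between them is shorter than \<open>m\<close>. Inserting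
  \<open>s + i\<close> gives a chain with one jump too many, and the last is dropped.\<close>

lemma chain_Suc_greedy:
  assumes "chain P m (Suc j) s"
  obtains i where "i \<in> {1..m}" "P (s + i)" "\<And>u. 1 \<le> u \<Longrightarrow> u < i \<Longrightarrow> \<not> P (s + u)"
    "chain P m j (s + i)"
proof -
  obtain i' where i': "i' \<in> {1..m}" "P (s + i')" "chain P m j (s + i')" using assms by auto
  define i where "i = (LEAST i. 1 \<le> i \<and> P (s + i))"
  have i: "1 \<le> i \<and> P (s + i)" unfolding i_def by (rule LeastI[of _ i']) (use i' in auto)
  have le: "i \<le> i'" unfolding i_def by (rule Least_le) (use i' in auto)
  have first: "\<not> P (s + u)" if "1 \<le> u" "u < i" for u
    using not_less_Least[of u "\<lambda>i. 1 \<le> i \<and> P (s + i)"] that unfolding i_def by blast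
  have "chain P m j (s + i)"
  proof (cases "i = i'")
    case False
    then have "\<exists>e\<in>{1..m}. P (s + i + e) \<and> chain P m j (s + i + e)"
      using le i' by (intro bexI[of _ "i' - i"]) auto
    then show ?thesis using chain_Suc_imp_chain[of P m j "s + i"] by simp
  qed (use i' in simp)
  then show ?thesis using that[of i] i first le i'(1) by auto
qed

text \<open>Sets are sorted by their first greedy jump \<open>i\<close>. This fixes membership of
  \<open>i\<close> points, a factor \<open>2^-i\<close>, and the induction hypothesis counts the
  rest; summing over \<open>i\<close> gives \<open>1 - 2^-m\<close> per jump. The hypothesis on
  \<open>V\<close> says that the points after \<open>s\<close> lying in \<open>V\<close> form an
  initial segment, which survives the removal of the fixed points.\<close>

lemma card_chain_subsets_le:
  fixes q :: "nat \<Rightarrow> 'a"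
  assumes "finite V" "inj q" "\<And>t u. s < u \<Longrightarrow> u < t \<Longrightarrow> q t \<in> V \<Longrightarrow> q u \<in> V"
  shows "real (card {A \<in> Pow V. chain (\<lambda>t. q t \<in> A) m j s}) \<le> 2 ^ card V * (1 - 1 / 2 ^ m) ^ j"
  using assms(1,3)
proof (induction j arbitrary: V s)
  case 0
  then show ?case by (simp add: card_Pow flip: Pow_def)
next
  case (Suc j)
  define p :: real where "p = 1 - 1 / 2 ^ m"
  define D where "D i = {A \<in> Pow V. q (s + i) \<in> A \<and> (\<forall>u. 1 \<le> u \<longrightarrow> u < i \<longrightarrow> q (s + u) \<notin> A) \<and>
      chain (\<lambda>t. q t \<in> A) m j (s + i)}" for i
  have p0: "p \<ge> 0" unfolding p_def by simp
  have finD: "finite (D i)" for i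
    using Suc.prems(1) unfolding D_def by simp
  have cardD: "real (card (D i)) \<le> 2 ^ card V * p ^ j * (1 / 2) ^ i" if i: "i \<in> {1..m}" for i
  proof (cases "q (s + i) \<in> V")
    case False
    then have "D i = {}" unfolding D_def by auto
    then show ?thesis using p0 by simp
  next
    case True
    \<comment> \<open>The points decided by the first jump: all but the last are outside
      \<open>A\<close>. Hence \<open>A - X\<close> determines \<open>A\<close>, and the remaining
      chain depends on \<open>A - X\<close> only.\<close>
    define X where "X = q ` {s<..s + i}"
    have X: "X \<subseteq> V"
    proof
      fix x assume "x \<in> X"
      then obtain u where "s < u" "u \<le> s + i" "x = q u" unfolding X_def by auto
      then show "x \<in> V" using Suc.prems(2)[of u "s + i"] True by (cases "u = s + i") auto
    qed
    have cX: "card X = i" unfolding X_def by (simp add: card_image inj_on_subset[OF assms(2)])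
    have qX: "q t \<notin> X" if "t > s + i" for t
      unfolding X_def using that assms(2) by (auto dest: injD)
    let ?E = "{A \<in> Pow (V - X). chain (\<lambda>t. q t \<in> A) m j (s + i)}"
    have inter: "A \<inter> X = {q (s + i)}" if A: "A \<in> D i" for A
    proof -
      have "x = q (s + i)" if x: "x \<in> A" "x \<in> X" for x
      proof -
        obtain u where u: "s < u" "u \<le> s + i" "x = q u" using x(2) unfolding X_def by auto
        have "q (s + (u - s)) \<in> A" using u x by simp
        moreover have "1 \<le> u - s" using u by simp
        ultimately have "\<not> u - s < i" using A unfolding D_def by blast
        then show ?thesis using u by (metis add_diff_inverse_nat le_antisym le_diff_conv2
            less_imp_le_nat linorder_not_less add.commute)
      qed
      moreover have "q (s + i) \<in> A \<inter> X" using A i unfolding D_def X_def by auto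
      ultimately show ?thesis by blast
    qed
    have inj: "inj_on (\<lambda>A. A - X) (D i)"
      by (rule inj_onI) (metis Int_Diff_Un inter)
    have "(\<lambda>A. A - X) ` D i \<subseteq> ?E"
    proof
      fix B assume "B \<in> (\<lambda>A. A - X) ` D i"
      then obtain A where A: "A \<in> D i" "B = A - X" by blast
      have "chain (\<lambda>t. q t \<in> A) m j (s + i) = chain (\<lambda>t. q t \<in> B) m j (s + i)"
        by (rule chain_cong) (use qX A(2) in auto)
      then show "B \<in> ?E" using A unfolding D_def by auto
    qed
    then have "card (D i) \<le> card ?E"
      by (rule card_inj_on_le[OF inj]) (use Suc.prems(1) in simp)
    moreover have "real (card ?E) \<le> 2 ^ card (V - X) * p ^ j"
      unfolding p_def
    proof (rule Suc.IH)
      fix t u assume "s + i < u" "u < t" "q t \<in> V - X"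
      then show "q u \<in> V - X" using Suc.prems(2)[of u t] qX by auto
    qed (use Suc.prems(1) in simp)
    moreover have "(2 :: real) ^ card (V - X) = 2 ^ card V * (1 / 2) ^ i"
    proof -
      have "card (V - X) = card V - i" "i \<le> card V"
        using X cX Suc.prems(1) card_mono[OF Suc.prems(1) X]
        by (auto simp: card_Diff_subset finite_subset)
      then show ?thesis by (simp add: power_diff power_divide)
    qed
    ultimately show ?thesis by (simp add: mult_ac)
  qed
  have "{A \<in> Pow V. chain (\<lambda>t. q t \<in> A) m (Suc j) s} \<subseteq> (\<Union>i\<in>{1..m}. D i)"
  proof
    fix A assume "A \<in> {A \<in> Pow V. chain (\<lambda>t. q t \<in> A) m (Suc j) s}"
    then have A: "A \<subseteq> V" "chain (\<lambda>t. q t \<in> A) m (Suc j) s" by blast+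
    obtain i where "i \<in> {1..m}" "A \<in> D i"
      by (rule chain_Suc_greedy[OF A(2)]) (use A(1) in \<open>simp add: D_def\<close>)
    then show "A \<in> (\<Union>i\<in>{1..m}. D i)" by blast
  qed
  then have "card {A \<in> Pow V. chain (\<lambda>t. q t \<in> A) m (Suc j) s} \<le> card (\<Union>i\<in>{1..m}. D i)"
    by (intro card_mono) (use finD in auto)
  also have "\<dots> \<le> (\<Sum>i\<in>{1..m}. card (D i))"
    by (rule card_UN_le) simp
  finally have "real (card {A \<in> Pow V. chain (\<lambda>t. q t \<in> A) m (Suc j) s})
      \<le> (\<Sum>i\<in>{1..m}. real (card (D i)))"
    by (simp only: of_nat_le_iff flip: of_nat_sum)
  also have "\<dots> \<le> (\<Sum>i\<in>{1..m}. 2 ^ card V * p ^ j * (1 / 2) ^ i)"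
    by (rule sum_mono) (rule cardD)
  also have "\<dots> = 2 ^ card V * p ^ j * (\<Sum>i\<in>{1..m}. (1 / 2) ^ i)"
    by (rule sum_distrib_left[symmetric])
  also have "(\<Sum>i\<in>{1..m}. (1 / 2 :: real) ^ i) = p"
    unfolding p_def by (induction m) (auto simp: field_simps)
  finally show ?case unfolding p_def by (simp add: mult_ac)
qed

text \<open>The multipliers of \<open>d\<close> are the jump lengths, so the index \<open>s\<close>
  advances by \<open>i\<close> along the list. The head \<open>x\<close> need not lie in
  \<open>A\<close>, as in \<open>chain\<close>.\<close>

lemma chain_of_steps:
  assumes "\<And>j. Suc j < length (x # xs) \<Longrightarrow>
      (x # xs) ! Suc j - (x # xs) ! j \<in> {int i * d |i. 1 \<le> i \<and> i \<le> m}"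
    and "x = a + int s * d" "set xs \<subseteq> A"
  shows "chain (\<lambda>t. a + int t * d \<in> A) m (length xs) s"
  using assms
proof (induction xs arbitrary: x s)
  case (Cons y ys)
  obtain i where i: "1 \<le> i" "i \<le> m" "y - x = int i * d"
    using Cons.prems(1)[of 0] by auto
  have y: "y = a + int (s + i) * d" using i(3) Cons.prems(2) by (simp add: algebra_simps)
  have "chain (\<lambda>t. a + int t * d \<in> A) m (length ys) (s + i)"
  proof (rule Cons.IH[OF _ y])
    fix j assume "Suc j < length (y # ys)"
    then show "(y # ys) ! Suc j - (y # ys) ! j \<in> {int i * d |i. 1 \<le> i \<and> i \<le> m}"
      using Cons.prems(1)[of "Suc j"] by simp
  qed (use Cons.prems(3) in simp)
  moreover have "a + int (s + i) * d \<in> A" using y Cons.prems(3) by simp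
  ultimately show ?case using i(1,2) by auto
qed simp

section \<open>The lower bound\<close>

text \<open>\<open>A\<close> stands for a colour class. The first term is tested by
  \<open>a \<in> A\<close>, leaving \<open>k - 1\<close> jumps.\<close>

definition bad :: "nat \<Rightarrow> nat \<Rightarrow> nat \<Rightarrow> int \<Rightarrow> int \<Rightarrow> int set set" where
  "bad m k N a d = {A \<in> Pow {1..int N}. a \<in> A \<and> chain (\<lambda>t. a + int t * d \<in> A) m (k - 1) 0}"

text \<open>The condition \<open>a \<in> A\<close> halves the count; the chain then concerns only
  the points other than \<open>a\<close>.\<close>

lemma card_bad_le:
  assumes "a \<in> {1..int N}" "d > 0"
  shows "real (card (bad m k N a d)) \<le> 2 ^ N / 2 * (1 - 1 / 2 ^ m) ^ (k - 1)"
proof -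
  let ?V = "{1..int N} - {a}"
  let ?E = "{A \<in> Pow ?V. chain (\<lambda>t. a + int t * d \<in> A) m (k - 1) 0}"
  have "inj_on (\<lambda>A. A - {a}) (bad m k N a d)"
    by (rule inj_onI) (auto simp: bad_def)
  moreover have "(\<lambda>A. A - {a}) ` bad m k N a d \<subseteq> ?E"
  proof
    fix B assume "B \<in> (\<lambda>A. A - {a}) ` bad m k N a d"
    then obtain A where A: "A \<in> bad m k N a d" "B = A - {a}" by blast
    have "chain (\<lambda>t. a + int t * d \<in> A) m (k - 1) 0 = chain (\<lambda>t. a + int t * d \<in> B) m (k - 1) 0"
      by (rule chain_cong) (use A(2) assms(2) in auto)
    then show "B \<in> ?E" using A unfolding bad_def by auto
  qed
  ultimately have "card (bad m k N a d) \<le> card ?E"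
    by (rule card_inj_on_le) simp
  moreover have "real (card ?E) \<le> 2 ^ card ?V * (1 - 1 / 2 ^ m) ^ (k - 1)"
  proof (rule card_chain_subsets_le)
    show "inj (\<lambda>t. a + int t * d)" using assms(2) by (auto simp: inj_def)
    fix t u :: nat
    assume tu: "0 < u" "u < t" "a + int t * d \<in> ?V"
    have "int u * d \<le> int t * d" "0 < int u * d" using tu(1,2) assms(2) by auto
    moreover have "1 \<le> a" "a + int t * d \<le> int N" using tu(3) assms(1) by auto
    ultimately have "1 \<le> a + int u * d" "a + int u * d \<le> int N" "a + int u * d \<noteq> a" by linarith+
    then show "a + int u * d \<in> ?V" by simp
  qed simp
  moreover have "(2 :: real) ^ card ?V = 2 ^ N / 2"
  proof -
    have "N \<ge> 1" using assms(1) by auto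
    then show ?thesis using assms(1) by (simp add: power_diff)
  qed
  ultimately show ?thesis by simp
qed

text \<open>Union bound: every \<open>C\<close> or its complement is bad for some
  \<open>(a, d)\<close>. The factor 2 for the two colours cancels the half in
  \<open>card_bad_le\<close>.\<close>

lemma forcing_imp_pow_le:
  assumes "k \<ge> 2" and forcing: "semi_progression_forcing m k N"
  shows "1 \<le> real N * (real N - 1) / 2 * (1 - 1 / 2 ^ m) ^ (k - 1)"
proof -
  define p :: real where "p = (1 - 1 / 2 ^ m) ^ (k - 1)"
  define V where "V = {1..int N}"
  \<comment> \<open>Pairs \<open>(a + d - 1, a - 1)\<close> for the first term \<open>a\<close> and
    low-difference \<open>d\<close> with \<open>a + d \<le> N\<close>.\<close>
  define T where "T = (SIGMA e:{..<N}. {..<e})"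
  define R where "R x = bad m k N (int (snd x) + 1) (int (fst x) - int (snd x))" for x :: "nat \<times> nat"
  have "Pow V \<subseteq> (\<Union>x\<in>T. R x \<union> (\<lambda>A. V - A) ` R x)"
  proof
    fix C assume C: "C \<in> Pow V"
    obtain xs where xs: "semi_progression m k xs" "set xs \<subseteq> V" "monochromatic (\<lambda>x. x \<in> C) xs"
      using forcing unfolding semi_progression_forcing_def V_def by blast
    obtain b where b: "\<forall>x\<in>set xs. (x \<in> C) = b" using xs(3) unfolding monochromatic_def by blast
    define A where "A = (if b then C else V - C)"
    have A: "A \<subseteq> V" "set xs \<subseteq> A" "C = A \<or> C = V - A"
      using b xs(2) C unfolding A_def by (auto split: if_splits)
    obtain d where d: "d > 0" "\<And>j. Suc j < k \<Longrightarrow>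
        xs ! Suc j - xs ! j \<in> {int i * d |i. 1 \<le> i \<and> i \<le> m}" and len: "length xs = k"
      using xs(1) unfolding semi_progression_def by blast
    \<comment> \<open>The second term, present as \<open>k \<ge> 2\<close>, forces
      \<open>a + d \<le> y \<le> N\<close>; this limits the pairs to
      \<open>N (N - 1) / 2\<close>.\<close>
    obtain a y zs where xs_eq: "xs = a # y # zs"
      using len assms(1) by (metis Suc_le_length_iff numeral_2_eq_2)
    have ch: "chain (\<lambda>t. a + int t * d \<in> A) m (length (y # zs)) 0"
      by (rule chain_of_steps[where x = a]) (use d(2) len A(2) xs_eq in auto)
    obtain i where i: "1 \<le> i" "y - a = int i * d" using d(2)[of 0] assms(1) xs_eq by auto
    then have "d \<le> y - a" using d(1) by simp
    then have ad: "1 \<le> a" "a + d \<le> int N" using A(1,2) xs_eq unfolding V_def by auto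
    have Abad: "A \<in> bad m k N a d"
      using ch A(1,2) len xs_eq unfolding bad_def V_def by (auto simp del: chain.simps)
    define x where "x = (nat (a + d - 1), nat (a - 1))"
    have "x \<in> T" unfolding T_def x_def using ad d(1) by auto
    moreover have "A \<in> R x" using Abad ad d(1) unfolding R_def x_def by simp
    ultimately show "C \<in> (\<Union>x\<in>T. R x \<union> (\<lambda>A. V - A) ` R x)" using A(3) by blast
  qed
  moreover have fin: "finite T" "\<And>x. finite (R x)"
    unfolding T_def R_def bad_def by auto
  ultimately have "card (Pow V) \<le> card (\<Union>x\<in>T. R x \<union> (\<lambda>A. V - A) ` R x)"
    by (intro card_mono) auto
  also have "\<dots> \<le> (\<Sum>x\<in>T. card (R x \<union> (\<lambda>A. V - A) ` R x))"
    by (rule card_UN_le) (rule fin)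
  also have "\<dots> \<le> (\<Sum>x\<in>T. 2 * card (R x))"
  proof (rule sum_mono)
    fix x
    show "card (R x \<union> (\<lambda>A. V - A) ` R x) \<le> 2 * card (R x)"
      using card_Un_le[of "R x" "(\<lambda>A. V - A) ` R x"] card_image_le[OF fin(2), of "\<lambda>A. V - A" x]
      by linarith
  qed
  finally have "2 ^ N \<le> (\<Sum>x\<in>T. 2 * card (R x))" by (simp add: card_Pow V_def)
  then have "real (2 ^ N) \<le> real (\<Sum>x\<in>T. 2 * card (R x))" by (rule of_nat_mono)
  also have "\<dots> = (\<Sum>x\<in>T. 2 * real (card (R x)))" by simp
  also have "\<dots> \<le> (\<Sum>x\<in>T. 2 ^ N * p)"
  proof (rule sum_mono)
    fix x assume "x \<in> T"
    then have "real (card (R x)) \<le> 2 ^ N / 2 * p"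
      unfolding R_def p_def T_def by (intro card_bad_le) auto
    then show "2 * real (card (R x)) \<le> 2 ^ N * p" by simp
  qed
  also have "\<dots> = 2 ^ N * (real (card T) * p)" by simp
  finally have "1 \<le> real (card T) * p" by simp
  moreover have "real (card T) = real N * (real N - 1) / 2"
  proof -
    have "card T = (\<Sum>e<N. e)" unfolding T_def by simp
    moreover have "real (\<Sum>e<N. e) = real N * (real N - 1) / 2"
      by (induction N) (auto simp: field_simps)
    ultimately show ?thesis by simp
  qed
  ultimately show ?thesis unfolding p_def by simp
qed

lemma forcing_lower_bound:
  assumes "m \<ge> 1" "k \<ge> 2" "N \<ge> 1" "semi_progression_forcing m k N"
  shows "\<alpha> m ^ k < real N"
proof (rule power_less_imp_less_base)
  define p :: real where "p = 1 - 1 / 2 ^ m"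
  have "(2 :: real) ^ 1 \<le> 2 ^ m" using assms(1) by (intro power_increasing) auto
  then have p: "p \<ge> 1 / 2" unfolding p_def by (simp add: field_simps)
  then have pk: "p ^ k > 0" by simp
  have \<alpha>2: "(\<alpha> m)\<^sup>2 = 1 / p"
    using \<open>2 ^ 1 \<le> 2 ^ m\<close> unfolding \<alpha>_def p_def by (simp add: field_simps)
  \<comment> \<open>Multiplying by \<open>p\<close> turns the exponent into \<open>k\<close>; since
    \<open>p \<ge> 1 / 2\<close>, the left side later cancels the half in the pair count.\<close>
  have "p \<le> real N * (real N - 1) / 2 * p ^ (k - 1) * p"
    using forcing_imp_pow_le[OF assms(2,4)] p unfolding p_def[symmetric]
    by (simp add: mult_le_cancel_right1)
  also have "\<dots> = real N * (real N - 1) / 2 * p ^ k"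
    using assms(2) by (simp add: power_eq_if)
  also have "\<dots> < (real N)\<^sup>2 / 2 * p ^ k"
    using pk assms(3) by (intro mult_strict_right_mono) (auto simp: power2_eq_square)
  finally have "1 / p ^ k < (real N)\<^sup>2"
    using p pk by (simp add: field_simps)
  moreover have "(\<alpha> m ^ k)\<^sup>2 = 1 / p ^ k"
    using \<alpha>2 by (metis power_mult mult.commute power_one_over)
  ultimately show "(\<alpha> m ^ k)\<^sup>2 < (real N)\<^sup>2" by simp
qed simp

theorem mainTheorem1:
  fixes m k :: nat
  assumes "m \<ge> 1" and "k \<ge> 2"
  shows "real (S m k) > \<alpha> m ^ k"
proof -
  \<comment> \<open>Existence of a forcing number ensures that the least one is itself
    forcing.\<close>
  have "1 \<le> S m k \<and> semi_progression_forcing m k (S m k)"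
    unfolding S_def by (rule LeastI_ex) (use semi_progression_forcing_exists[OF assms(1)] in blast)
  then show ?thesis using forcing_lower_bound[OF assms] by blast
qed

end
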